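(* Let the 3-pan be the graph on vertices $e_1,e_2,e_3,e_4$ with edges $e_1e_2$, $e_2e_3$, $e_2e_4$, $e_3e_4$. Let $H$ be the $(e_1,1)$-ordering of the 3-pan. Then $R_<(H)\le 10$.
   Context: A $k$-ordering of a graph $H$ assigns distinct order-labels from $\{1,\ldots,|H|\}$ to $k$ of the vertices of $H$. For a vertex $v$ of $H$ and $1\le l\le |H|$, the $(v,l)$-ordering of $H$ is the 1-ordering in which $v$ receives order-label $l$ and no other vertex is labeled. An ordered 2-coloring on $n$ vertices is a red/blue coloring of the edges of the complete graph on vertex set $\{1,\ldots,n\}$. It contains a $k$-ordering $H$ (in a given color) if it has a subgraph isomorphic to $H$, all of whose edges have that color, such that for every $i$ the $i$-th smallest vertex of the copy corresponds to a vertex of $H$ that has order-label $i$ or no order-label. $R_<(H)$ is the least $n$ such that every ordered 2-coloring on $n$ vertices contains a monochromatic (red or blue) copy of $H$. *)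

theory Defs
  imports Main "HOL-Library.Extended_Nat"
begin

record 'a graph =
  verts :: "'a set"
  edges :: "'a set set"

text \<open>A missing label (\<^term>\<open>None\<close>) means that the vertex carries no order-label.\<close>

record 'a ordered_graph = "'a graph" +
  order_label :: "'a \<Rightarrow> nat option"

definition simple_graph :: "('a, 'b) graph_scheme \<Rightarrow> bool" where
  "simple_graph G \<longleftrightarrow> finite (verts G) \<and> (\<forall>e \<in> edges G. e \<subseteq> verts G \<and> card e = 2)"

definition is_ordering :: "nat \<Rightarrow> 'a ordered_graph \<Rightarrow> bool" where
  "is_ordering k H \<longleftrightarrow> simple_graph H \<and>
     dom (order_label H) \<subseteq> verts H \<and> card (dom (order_label H)) = k \<and>
     inj_on (order_label H) (dom (order_label H)) \<and>
     ran (order_label H) \<subseteq> {1..card (verts H)}"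

definition single_ordering :: "'a graph \<Rightarrow> 'a \<Rightarrow> nat \<Rightarrow> 'a ordered_graph" where
  "single_ordering G v l =
     \<lparr>verts = verts G, edges = edges G, order_label = [v \<mapsto> l]\<rparr>"

definition complete_graph :: "nat \<Rightarrow> nat graph" where
  "complete_graph n = \<lparr>verts = {1..n}, edges = {e. e \<subseteq> {1..n} \<and> card e = 2}\<rparr>"

definition subgraph :: "'a graph \<Rightarrow> 'a graph \<Rightarrow> bool" where
  "subgraph K G \<longleftrightarrow> simple_graph K \<and> verts K \<subseteq> verts G \<and> edges K \<subseteq> edges G"

definition graph_iso ::
  "('a \<Rightarrow> 'b) \<Rightarrow> ('a, 'c) graph_scheme \<Rightarrow> ('b, 'd) graph_scheme \<Rightarrow> bool" where
  "graph_iso f H K \<longleftrightarrow> bij_betw f (verts H) (verts K) \<and>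
     (\<forall>u \<in> verts H. \<forall>v \<in> verts H. {u, v} \<in> edges H \<longleftrightarrow> {f u, f v} \<in> edges K)"

text \<open>The \<open>i\<close>-th smallest element, counting from 1, of a finite set \<open>S\<close>;
  meaningful for \<open>1 \<le> i \<le> card S\<close> only.\<close>

definition ith_smallest :: "nat \<Rightarrow> nat set \<Rightarrow> nat" where
  "ith_smallest i S = sorted_list_of_set S ! (i - 1)"

datatype color = Red | Blue

text \<open>A coloring is a total function on sets of numbers; only its values on the edges of
  \<open>complete_graph n\<close> matter for a coloring on \<open>n\<close> vertices.\<close>

definition contains_copy ::
  "nat \<Rightarrow> (nat set \<Rightarrow> color) \<Rightarrow> color \<Rightarrow> 'a ordered_graph \<Rightarrow> bool" where
  "contains_copy n \<chi> c H \<longleftrightarrow>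
     (\<exists>K f. subgraph K (complete_graph n) \<and> graph_iso f H K \<and>
        (\<forall>e \<in> edges K. \<chi> e = c) \<and>
        (\<forall>i \<in> {1..card (verts H)}. \<forall>v \<in> verts H.
           f v = ith_smallest i (verts K) \<longrightarrow>
             order_label H v = Some i \<or> order_label H v = None))"

text \<open>The value is \<open>\<infinity>\<close> if no suitable \<open>n\<close> exists, so that an upper bound by a number
  includes the existence of such an \<open>n\<close>.\<close>

definition ordered_ramsey :: "'a ordered_graph \<Rightarrow> enat" where
  "ordered_ramsey H =
     Inf (enat ` {n. \<forall>\<chi>. \<exists>c. contains_copy n \<chi> c H})"

datatype pan_vertex = e1 | e2 | e3 | e4

definition three_pan :: "pan_vertex graph" where
  "three_pan = \<lparr>verts = {e1, e2, e3, e4},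
     edges = {{e1, e2}, {e2, e3}, {e2, e4}, {e3, e4}}\<rparr>"

lemma is_ordering_single_ordering:
  assumes "simple_graph G" "v \<in> verts G" "l \<in> {1..card (verts G)}"
  shows "is_ordering 1 (single_ordering G v l)"
  using assms by (auto simp: is_ordering_def single_ordering_def simple_graph_def)

lemma simple_graph_three_pan: "simple_graph three_pan"
  by (auto simp: simple_graph_def three_pan_def)

end

theory Submission
  imports Defs
begin

text \<open>If no copy exists, a monochromatic triangle is joined to every smaller vertex entirely in the
  other color. Some triangle \<open>T\<close> in \<open>{5..10}\<close> is monochromatic, say red, so \<open>1, 2, 3, 4\<close> are blue to
  \<open>T\<close>. A blue edge inside \<open>{2, 3, 4}\<close> would form with a vertex of \<open>T\<close> a blue triangle having a blue
  edge to \<open>1\<close>; hence \<open>{2, 3, 4}\<close> is red, and \<open>1\<close> is blue to it. Let \<open>u \<in> {5..10} - T\<close>. If \<open>u\<close> is blue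
  both to some \<open>v \<in> {2, 3, 4}\<close> and to some \<open>t \<in> T\<close>, then \<open>{v, t, u}\<close> is a blue triangle with a blue
  edge to \<open>1\<close>. Otherwise \<open>u\<close> completes \<open>{2, 3, 4}\<close> or \<open>T\<close> to a red \<open>K\<^sub>4\<close>, which contains a copy.\<close>

lemma color_trichotomy: "p = q \<or> p = r \<or> q = r" for p q r :: color
  by (cases p; cases q; cases r) auto

text \<open>Some vertex \<open>v\<close> has three neighbors in one color \<open>k\<close> by
  pigeonhole. Either an edge among these three has color \<open>k\<close> and closes a triangle with
  \<open>v\<close>, or all three edges among them share the other color.\<close>

lemma monochromatic_triangle:
  fixes \<chi> :: "'a set \<Rightarrow> color"
  assumes "card V \<ge> 6"
  obtains a b c where "a \<in> V" "b \<in> V" "c \<in> V" "a \<noteq> b" "a \<noteq> c" "b \<noteq> c"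
    "\<chi> {a, c} = \<chi> {a, b}" "\<chi> {b, c} = \<chi> {a, b}"
proof -
  obtain v where v: "v \<in> V"
    using assms by fastforce
  define N where "N k = {w \<in> V - {v}. \<chi> {v, w} = k}" for k
  have fin: "finite V"
    using assms card.infinite by force
  have "V - {v} = N Red \<union> N Blue"
    unfolding N_def using color.exhaust by auto
  then have "card (V - {v}) \<le> card (N Red) + card (N Blue)"
    by (metis card_Un_le)
  then have "card (N Red) \<ge> 3 \<or> card (N Blue) \<ge> 3"
    using assms v fin by simp linarith
  then obtain k S where "S \<subseteq> N k" "card S = 3"
    by (metis obtain_subset_with_card_n)
  then obtain a b c where abc: "{a, b, c} \<subseteq> N k" "a \<noteq> b" "a \<noteq> c" "b \<noteq> c"
    by (auto simp: card_3_iff)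
  show thesis
  proof (cases "\<chi> {a, b} = k \<or> \<chi> {a, c} = k \<or> \<chi> {b, c} = k")
    case True
    then show thesis
      using abc v that[of v a b] that[of v a c] that[of v b c] unfolding N_def by auto
  next
    case False
    then show thesis
      using abc that[of a b c] color_trichotomy unfolding N_def by blast
  qed
qed

text \<open>The minimum heads the sorted list, whose entries are distinct.\<close>

lemma ith_smallest_eq_Min_imp:
  assumes "finite S" "i \<in> {1..card S}" "ith_smallest i S = Min S"
  shows "i = 1"
proof -
  have "S \<noteq> {}"
    using assms(2) by auto
  then have "sorted_list_of_set S ! (i - 1) = sorted_list_of_set S ! 0"
    using assms by (simp add: ith_smallest_def sorted_list_of_set_nonempty)
  then show ?thesis
    using assms(1,2) by (auto simp: nth_eq_iff_index_eq)
qed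

text \<open>Only \<open>e1\<close> carries a label, so the order of \<open>a\<close>,
  \<open>b\<close>, \<open>c\<close> is irrelevant: it suffices that \<open>x\<close>, in the role
  of \<open>e1\<close>, is the minimum of the copy.\<close>

lemma contains_copy_pan:
  assumes "1 \<le> x" "x < a" "x < b" "x < c" "a \<le> n" "b \<le> n" "c \<le> n"
    and "a \<noteq> b" "a \<noteq> c" "b \<noteq> c"
    and "\<chi> {x, a} = k" "\<chi> {a, b} = k" "\<chi> {a, c} = k" "\<chi> {b, c} = k"
  shows "contains_copy n \<chi> k (single_ordering three_pan e1 1)" (is "contains_copy n \<chi> k ?H")
proof -
  define K :: "nat graph" where
    "K = \<lparr>verts = {x, a, b, c}, edges = {{x, a}, {a, b}, {a, c}, {b, c}}\<rparr>"
  define f where "f = case_pan_vertex x a b c"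
  have distinct: "x \<noteq> a" "x \<noteq> b" "x \<noteq> c" "a \<noteq> b" "a \<noteq> c" "b \<noteq> c"
      "a \<noteq> x" "b \<noteq> x" "c \<noteq> x" "b \<noteq> a" "c \<noteq> a" "c \<noteq> b"
    using assms by auto
  have first: "i = 1" if "i \<in> {1..4}" "x = ith_smallest i (verts K)" for i
  proof (rule ith_smallest_eq_Min_imp)
    have "Min (verts K) = x"
      using assms(2-4) by (intro Min_eqI) (auto simp: K_def)
    then show "ith_smallest i (verts K) = Min (verts K)"
      using that by simp
    have "card (verts K) = 4"
      using distinct by (simp add: K_def)
    then show "i \<in> {1..card (verts K)}"
      using that by simp
  qed (simp add: K_def)
  have "subgraph K (complete_graph n)"
    using assms by (auto simp: K_def subgraph_def complete_graph_def simple_graph_def)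
  moreover have "graph_iso f ?H K"
    using distinct
    by (simp add: graph_iso_def single_ordering_def three_pan_def K_def f_def bij_betw_def
        doubleton_eq_iff)
  moreover have "\<forall>e \<in> edges K. \<chi> e = k"
    using assms by (auto simp: K_def)
  moreover have "\<forall>i \<in> {1..card (verts ?H)}. \<forall>v \<in> verts ?H. f v = ith_smallest i (verts K) \<longrightarrow>
      order_label ?H v = Some i \<or> order_label ?H v = None"
  proof (intro ballI impI)
    fix i v
    assume i: "i \<in> {1..card (verts ?H)}" and v: "f v = ith_smallest i (verts K)"
    have "i \<in> {1..4}"
      using i by (simp add: single_ordering_def three_pan_def)
    with v first[of i] show "order_label ?H v = Some i \<or> order_label ?H v = None"
      by (cases v) (simp_all add: single_ordering_def f_def)
  qed
  ultimately show ?thesis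
    unfolding contains_copy_def by blast
qed

lemma pan_in_ten_vertices: "\<exists>k. contains_copy 10 \<chi> k (single_ordering three_pan e1 1)"
proof (rule ccontr)
  assume no_copy: "\<nexists>k. contains_copy 10 \<chi> k (single_ordering three_pan e1 1)"
  have no_pan: "\<chi> {x, a} \<noteq> \<chi> {a, b}"
    if "1 \<le> x" "x < a" "x < b" "x < c" "a \<le> 10" "b \<le> 10" "c \<le> 10"
      "a \<noteq> b" "a \<noteq> c" "b \<noteq> c" "\<chi> {a, c} = \<chi> {a, b}" "\<chi> {b, c} = \<chi> {a, b}"
    for x a b c
    using contains_copy_pan[OF that(1-10), of \<chi> "\<chi> {a, b}"] that no_copy by auto
  obtain a b c where abc: "a \<in> {5..10}" "b \<in> {5..10}" "c \<in> {5..10}"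
      "a \<noteq> b" "a \<noteq> c" "b \<noteq> c" "\<chi> {a, c} = \<chi> {a, b}" "\<chi> {b, c} = \<chi> {a, b}"
    by (rule monochromatic_triangle[of "{5..10::nat}" \<chi>]) auto
  \<comment> \<open>\<open>red\<close> names whichever color the triangle has, so neither color
    needs a separate case.\<close>
  define red where "red = \<chi> {a, b}"
  have blue: "p = q" if "p \<noteq> red" "q \<noteq> red" for p q
    using that color_trichotomy by blast
  have T_red: "\<chi> {s, t} = red" if "s \<in> {a, b, c}" "t \<in> {a, b, c}" "s \<noteq> t" for s t
    using that abc by (auto simp: red_def insert_commute)
  have T_blue: "\<chi> {x, t} \<noteq> red" if x: "x \<in> {1..4}" and t: "t \<in> {a, b, c}" for x t
  proof -
    \<comment> \<open>By symmetry of the triangle, any \<open>t\<close> in it can play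
      \<open>e2\<close>, with the other two vertices as \<open>e3\<close> and
      \<open>e4\<close>.\<close>
    obtain s r where sr: "s \<in> {a, b, c}" "r \<in> {a, b, c}" "t \<noteq> s" "t \<noteq> r" "s \<noteq> r"
      using t abc(4-6) by blast
    have large: "x < y \<and> y \<le> 10" if "y \<in> {a, b, c}" for y
      using that x abc(1-3) by auto
    show ?thesis
      using no_pan[of x t s r] x sr(3-5) large[OF t] large[OF sr(1)] large[OF sr(2)]
        T_red[OF t sr(1,3)] T_red[OF t sr(2,4)] T_red[OF sr(1,2,5)]
      by simp
  qed
  \<comment> \<open>The triangle must meet \<open>{a, b, c}\<close>, since that is where
    \<open>1\<close> is known to send blue edges.\<close>
  have no_blue_triangle: "\<chi> {v, w} = red \<or> \<chi> {v, t} = red \<or> \<chi> {w, t} = red"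
    if "v \<in> {2..10}" "w \<in> {2..10}" "t \<in> {a, b, c}" "v \<noteq> w" "v \<noteq> t" "w \<noteq> t" for v w t
  proof (rule ccontr)
    assume "\<not> ?thesis"
    moreover have "\<chi> {1, t} \<noteq> red"
      using T_blue that by simp
    ultimately show False
      using no_pan[of 1 t v w] that abc blue by (auto simp: insert_commute)
  qed
  have red_234: "\<chi> {v, w} = red" if "v \<in> {2..4}" "w \<in> {2..4}" "v \<noteq> w" for v w
    using no_blue_triangle[of v w a] T_blue[of v a] T_blue[of w a] that abc by auto
  have "\<exists>u \<in> {5..10}. u \<notin> {a, b, c}"
  proof -
    have "card {a, b, c} < card {5..10::nat}"
      using abc by simp
    then show ?thesis
      by (metis card_mono finite.emptyI finite.insertI linorder_not_less subsetI)
  qed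
  then obtain u where u: "u \<in> {5..10}" "u \<notin> {a, b, c}"
    by blast
  consider v t where "v \<in> {2..4}" "t \<in> {a, b, c}" "\<chi> {v, u} \<noteq> red" "\<chi> {u, t} \<noteq> red"
    | "\<forall>v \<in> {2..4}. \<chi> {v, u} = red" | "\<forall>t \<in> {a, b, c}. \<chi> {u, t} = red"
    by blast
  then show False
  proof cases
    case 1
    then show False
      using no_blue_triangle[of v u t] T_blue[of v t] u abc by auto
  next
    case 2
    then show False
      \<comment> \<open>Since \<open>u\<close> is at least 5, the least vertex of the red complete
        graph on \<open>{2, 3, 4, u}\<close> is 2, which plays \<open>e1\<close>.\<close>
      using no_pan[of 2 3 4 u] red_234 u by auto
  next
    case 3
    have Q_red: "\<chi> {s, t} = red" if "s \<in> {a, b, c, u}" "t \<in> {a, b, c, u}" "s \<noteq> t" for s t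
      using that 3 T_red by (auto simp: insert_commute)
    \<comment> \<open>The position of \<open>u\<close> relative to \<open>a\<close>,
      \<open>b\<close>, \<open>c\<close> is unknown, so the role of \<open>e1\<close> goes to the
      minimum of all four.\<close>
    define m where "m = Min {a, b, c, u}"
    have m: "m \<in> {a, b, c, u}"
      unfolding m_def by (rule Min_in) auto
    have "card ({a, b, c, u} - {m}) = 3"
      using m abc u by (subst card_Diff_singleton) auto
    then obtain p q r where pqr: "{a, b, c, u} - {m} = {p, q, r}" "p \<noteq> q" "p \<noteq> r" "q \<noteq> r"
      by (auto simp: card_3_iff)
    have "y \<in> {a, b, c, u} \<and> m < y \<and> y \<le> 10" if "y \<in> {p, q, r}" for y
    proof -
      have y: "y \<in> {a, b, c, u}" "y \<noteq> m"
        using that pqr by auto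
      moreover have "m \<le> y"
        unfolding m_def using y by (intro Min_le) auto
      ultimately show ?thesis
        using abc u by auto
    qed
    then have y: "y \<in> {a, b, c, u}" "m < y" "y \<le> 10" if "y \<in> {p, q, r}" for y
      using that by blast+
    have "1 \<le> m"
      using m abc u by auto
    moreover have "\<chi> {m, p} = red" "\<chi> {p, q} = red" "\<chi> {p, r} = red" "\<chi> {q, r} = red"
      using Q_red[OF m y(1)] Q_red[OF y(1) y(1)] y(2) pqr(2-4) by auto
    ultimately show False
      using no_pan[of m p q r] y pqr by simp
  qed
qed

theorem theorem3p5:
  shows "ordered_ramsey (single_ordering three_pan e1 1) \<le> 10"
proof -
  have "ordered_ramsey (single_ordering three_pan e1 1) \<le> enat 10"
    unfolding ordered_ramsey_def using pan_in_ten_vertices by (intro Inf_lower) blast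
  then show ?thesis
    by (simp add: numeral_eq_enat)
qed

end
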